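(* Let $n\ge1$, let $(i_1,\dots,i_{n-1})$ be any ordering of the elements of $[n-1]$, and let $\varphi=\tau_{i_{n-1}}\circ\cdots\circ\tau_{i_1}:S_n\to S_n$ be the map that applies each of the simple transpositions $\tau_1,\dots,\tau_{n-1}$ exactly once, in that order. Then each of the following statistics on $S_n$ is homomesic for $\varphi$, with the indicated average (where one is given) over every orbit of $\varphi$. Entries: for each $i\in[n]$, the value $\pi(i)$ (average $\frac{n+1}{2}$); in particular $\pi(1)$, $\pi(n)$, $\pi(\lceil\frac{n+1}{2}\rceil)$ and $\pi(\lfloor\frac{n+1}{2}\rfloor)$. Excedance-related: for each $k\in[n]$, the number of $k$-excedances (average $\frac{n-k}{n}$; in particular for $k=1$ the small excedances, and for $k=2,3$ when $k\le n$) and the number of cyclical $k$-excedances (average $1$); the number of fixed points (average $1$); the number of excedances (average $\frac{n-1}{2}$); the number of weak excedances (average $\frac{n+1}{2}$); the number of indices that are not cyclical small excedances (average $n-1$); for $n\ge2$, the number of cyclical small weak excedances (average $2$) and the number of indices that are not cyclical small weak excedances (average $n-2$); the number of small weak excedances (average $1+\frac{n-1}{n}$); the number of indices that are not small weak excedances (average $\frac{(n-1)^2}{n}$); the number of indices that are not small excedances (average $n-\frac{n-1}{n}$); the number of cyclical small excedances (average $1$); the number of non-fixed points (average $n-1$); the number of weak deficiencies (average $\frac{n+1}{2}$); the number of deficiencies (average $\frac{n-1}{2}$); the number of big deficiencies (average $\frac{(n-1)(n-2)}{2n}$); the number of big excedances (average $\frac{(n-1)(n-2)}{2n}$); the number of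 even $i$ with $\pi(i)\le i$ plus the number of odd $i$ with $\pi(i)\ge i$ (average $\lfloor\frac{n+2}{2}\rfloor$). Inversion-related: the depth $\sum_{\pi(i)>i}(\pi(i)-i)$ (average $\frac1n\binom{n+1}{3}$); the inversion sum and the non-inversion sum (average $\frac12\binom{n+1}{3}$ each); $\sum_i(\pi(i)-i)^2$ (average $\binom{n+1}{3}$); the total displacement $\sum_i|\pi(i)-i|$ (average $\frac2n\binom{n+1}{3}$). Others: $\sum_i i\,\pi(i)$ (average $\frac{(n+1)^2n}{4}$); the number of $i$ with $i+\pi(i)$ prime; the number of $i$ with $i\,\pi(i)-1$ prime; the number of $i$ with $i\,\pi(i)+1$ prime; $\ell\sum_i\frac{1}{i+\pi(i)}$, where $\ell$ is the least common multiple of all possible values of $i+\sigma(i)$ for $\sigma\in S_n$, $i\in[n]$ (average $\frac{\ell}{n}\left((2n+1)H_{2n}-(2n+2)H_n\right)$); $\frac12\#\{i: i+\pi(i)\text{ odd}\}$ (average $\frac1n\lfloor\frac n2\rfloor\lceil\frac n2\rceil$).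
   Context: $[n]=\{1,\dots,n\}$ and $S_n$ is the set of permutations of $[n]$, written in one-line notation $\pi=\pi(1)\pi(2)\cdots\pi(n)$. For $i\in[n-1]$, $\tau_i:S_n\to S_n$ is the map (toggle) sending $\pi$ to the permutation obtained by swapping the entries $\pi(i)$ and $\pi(i+1)$ in positions $i$ and $i+1$. For a bijection $\varphi:S_n\to S_n$, the orbits are the sets $\{\varphi^m(\pi)\}$ of permutations obtained by applying $\varphi$ any number of times. A statistic $st$ is homomesic for $\varphi$ if there is a constant $c$ (the average) such that $\frac{1}{\#\mathcal{O}}\sum_{x\in\mathcal{O}}st(x)=c$ for every orbit $\mathcal{O}$. An index $i\in[n]$ is, for $\pi\in S_n$: an excedance if $\pi(i)>i$; a deficiency if $\pi(i)<i$; a weak excedance if $\pi(i)\ge i$; a weak deficiency if $\pi(i)\le i$; a big excedance if $\pi(i)>i+1$; a big deficiency if $\pi(i)<i-1$; a $k$-excedance if $\pi(i)=i+k$; a cyclical $k$-excedance if $\pi(i)\equiv i+k\pmod n$; a fixed point if $\pi(i)=i$; a small excedance if $\pi(i)=i+1$; a small weak excedance if $\pi(i)\in\{i,i+1\}$; a cyclical small excedance if $\pi(i)\equiv i+1\pmod n$; a cyclical small weak excedance if $\pi(i)=i$ or $\pi(i)\equiv i+1\pmod n$. An inversion of $\pi$ is a pair $i<j$ in $[n]$ with $\pi(j)<\pi(i)$; a non-inversion is a pair $i<j$ with $\pi(i)<\pi(j)$. The inversion sum (resp. non-inversion sum) is $\sum(j-i)$ over all inversions (resp. non-inversions). $H_m=\sum_{i=1}^m\frac1i$.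 *)

theory Defs
  imports
    "HOL-Combinatorics.Permutations"
    "HOL-Number_Theory.Cong"
    "HOL-Computational_Algebra.Primes"
    "HOL-Analysis.Harmonic_Numbers"
begin

abbreviation perms :: "nat \<Rightarrow> (nat \<Rightarrow> nat) set" where
  "perms n \<equiv> {\<pi>. \<pi> permutes {1..n}}"

(* Swaps the entries in positions i and i + 1 of the one-line notation, that is,
   acts on positions and not on values. *)
definition toggle :: "nat \<Rightarrow> (nat \<Rightarrow> nat) \<Rightarrow> nat \<Rightarrow> nat" where
  "toggle i \<pi> = \<pi> \<circ> Transposition.transpose i (i + 1)"

lemma bij_betw_toggle:
  assumes "i \<in> {1..n - 1}"
  shows "bij_betw (toggle i) (perms n) (perms n)"
proof -
  have t: "Transposition.transpose i (i + 1) permutes {1..n}"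
    using assms by (intro permutes_swap_id) auto
  show ?thesis
    by (rule bij_betw_byWitness[where f' = "toggle i"])
       (auto simp: toggle_def o_assoc[symmetric] intro: permutes_compose t[simplified])
qed

(* The maps to which homomesy is applied are bijections of the finite set X,
   so that the forward orbits below partition X. *)
definition orbits :: "('a \<Rightarrow> 'a) \<Rightarrow> 'a set \<Rightarrow> 'a set set" where
  "orbits \<phi> X = {{(\<phi> ^^ m) x | m. True} | x. x \<in> X}"

definition homomesic_avg :: "'a set \<Rightarrow> ('a \<Rightarrow> 'a) \<Rightarrow> ('a \<Rightarrow> real) \<Rightarrow> real \<Rightarrow> bool" where
  "homomesic_avg X \<phi> st c \<longleftrightarrow>
     (\<forall>\<O> \<in> orbits \<phi> X. 1 / real (card \<O>) * (\<Sum>x\<in>\<O>. st x) = c)"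

definition homomesic :: "'a set \<Rightarrow> ('a \<Rightarrow> 'a) \<Rightarrow> ('a \<Rightarrow> real) \<Rightarrow> bool" where
  "homomesic X \<phi> st \<longleftrightarrow> (\<exists>c. homomesic_avg X \<phi> st c)"

definition excedance :: "(nat \<Rightarrow> nat) \<Rightarrow> nat \<Rightarrow> bool" where
  "excedance \<pi> i \<longleftrightarrow> \<pi> i > i"

definition deficiency :: "(nat \<Rightarrow> nat) \<Rightarrow> nat \<Rightarrow> bool" where
  "deficiency \<pi> i \<longleftrightarrow> \<pi> i < i"

definition weak_excedance :: "(nat \<Rightarrow> nat) \<Rightarrow> nat \<Rightarrow> bool" where
  "weak_excedance \<pi> i \<longleftrightarrow> \<pi> i \<ge> i"

definition weak_deficiency :: "(nat \<Rightarrow> nat) \<Rightarrow> nat \<Rightarrow> bool" where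
  "weak_deficiency \<pi> i \<longleftrightarrow> \<pi> i \<le> i"

definition big_excedance :: "(nat \<Rightarrow> nat) \<Rightarrow> nat \<Rightarrow> bool" where
  "big_excedance \<pi> i \<longleftrightarrow> \<pi> i > i + 1"

definition big_deficiency :: "(nat \<Rightarrow> nat) \<Rightarrow> nat \<Rightarrow> bool" where
  "big_deficiency \<pi> i \<longleftrightarrow> int (\<pi> i) < int i - 1"

definition k_excedance :: "nat \<Rightarrow> (nat \<Rightarrow> nat) \<Rightarrow> nat \<Rightarrow> bool" where
  "k_excedance k \<pi> i \<longleftrightarrow> \<pi> i = i + k"

definition cyclical_k_excedance :: "nat \<Rightarrow> nat \<Rightarrow> (nat \<Rightarrow> nat) \<Rightarrow> nat \<Rightarrow> bool" where
  "cyclical_k_excedance n k \<pi> i \<longleftrightarrow> [\<pi> i = i + k] (mod n)"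

definition fixed_point :: "(nat \<Rightarrow> nat) \<Rightarrow> nat \<Rightarrow> bool" where
  "fixed_point \<pi> i \<longleftrightarrow> \<pi> i = i"

definition small_excedance :: "(nat \<Rightarrow> nat) \<Rightarrow> nat \<Rightarrow> bool" where
  "small_excedance \<pi> i \<longleftrightarrow> \<pi> i = i + 1"

definition small_weak_excedance :: "(nat \<Rightarrow> nat) \<Rightarrow> nat \<Rightarrow> bool" where
  "small_weak_excedance \<pi> i \<longleftrightarrow> \<pi> i \<in> {i, i + 1}"

definition cyclical_small_excedance :: "nat \<Rightarrow> (nat \<Rightarrow> nat) \<Rightarrow> nat \<Rightarrow> bool" where
  "cyclical_small_excedance n \<pi> i \<longleftrightarrow> [\<pi> i = i + 1] (mod n)"

definition cyclical_small_weak_excedance :: "nat \<Rightarrow> (nat \<Rightarrow> nat) \<Rightarrow> nat \<Rightarrow> bool" where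
  "cyclical_small_weak_excedance n \<pi> i \<longleftrightarrow> \<pi> i = i \<or> [\<pi> i = i + 1] (mod n)"

definition num_indices :: "nat \<Rightarrow> (nat \<Rightarrow> bool) \<Rightarrow> real" where
  "num_indices n P = real (card {i \<in> {1..n}. P i})"

definition inversions :: "nat \<Rightarrow> (nat \<Rightarrow> nat) \<Rightarrow> (nat \<times> nat) set" where
  "inversions n \<pi> = {(i, j). i \<in> {1..n} \<and> j \<in> {1..n} \<and> i < j \<and> \<pi> j < \<pi> i}"

definition non_inversions :: "nat \<Rightarrow> (nat \<Rightarrow> nat) \<Rightarrow> (nat \<times> nat) set" where
  "non_inversions n \<pi> = {(i, j). i \<in> {1..n} \<and> j \<in> {1..n} \<and> i < j \<and> \<pi> i < \<pi> j}"

definition inversion_sum :: "nat \<Rightarrow> (nat \<Rightarrow> nat) \<Rightarrow> real" where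
  "inversion_sum n \<pi> = (\<Sum>(i, j)\<in>inversions n \<pi>. real j - real i)"

definition non_inversion_sum :: "nat \<Rightarrow> (nat \<Rightarrow> nat) \<Rightarrow> real" where
  "non_inversion_sum n \<pi> = (\<Sum>(i, j)\<in>non_inversions n \<pi>. real j - real i)"

definition depth :: "nat \<Rightarrow> (nat \<Rightarrow> nat) \<Rightarrow> real" where
  "depth n \<pi> = (\<Sum>i | i \<in> {1..n} \<and> \<pi> i > i. real (\<pi> i) - real i)"

definition total_displacement :: "nat \<Rightarrow> (nat \<Rightarrow> nat) \<Rightarrow> real" where
  "total_displacement n \<pi> = (\<Sum>i = 1..n. \<bar>real (\<pi> i) - real i\<bar>)"

definition lcm_sums :: "nat \<Rightarrow> nat" where
  "lcm_sums n = Lcm {i + \<sigma> i | \<sigma> i. \<sigma> \<in> perms n \<and> i \<in> {1..n}}"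

end

theory Submission
  imports Defs "HOL-Combinatorics.Orbits"
begin

text \<open>
  A toggle multiplies a permutation on the right by a simple transposition, so \<open>\<phi> \<pi> = \<pi> \<circ> c\<close>
  for the product \<open>c\<close> of all the simple transpositions in the given order. Whatever the order,
  \<open>c\<close> is an \<open>n\<close>-cycle (lemma \<open>cyclic_on_position_perm\<close>): the transpositions are the edges of a
  path, and taken along the path, each inserts a further point into the cycle already built. Hence every orbit
  consists of the \<open>n\<close> permutations \<open>\<pi> \<circ> c ^^ m\<close> with \<open>m < n\<close>, and along it the entry in a fixed
  position takes every value in \<open>{1..n}\<close> exactly once (\<open>hom_entry_fun\<close>). By linearity, every
  statistic of the form \<open>\<Sum>i. w i (\<pi> i)\<close> is homomesic, and its average is the sum of \<open>w i j\<close> over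
  the whole square \<open>{1..n} \<times> {1..n}\<close> divided by \<open>n\<close> (\<open>hom_weight\<close>).

  All the statistics have this form for an evident weight \<open>w\<close>, except the inversion sum and the
  non-inversion sum, which look at two entries at a time. Their sum is constant, and their
  difference turns out to be \<open>\<Sum>j. j * (2 * \<pi> j - n - 1)\<close>, which has the right form again
  (\<open>non_inversion_sum_minus_inversion_sum\<close>). What remains is to evaluate double sums.
\<close>

section \<open>Products of all simple transpositions\<close>

text \<open>The product of simple transpositions by which a sequence of toggles multiplies on the
  right. The first toggle contributes the leftmost factor.\<close>

definition position_perm :: "nat list \<Rightarrow> nat \<Rightarrow> nat" where
  "position_perm ts = fold toggle ts id"

lemma fold_toggle_eq_comp: "fold toggle ts \<pi> = \<pi> \<circ> position_perm ts"
proof -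
  have "fold toggle ts (\<pi> \<circ> \<sigma>) = \<pi> \<circ> fold toggle ts \<sigma>" for \<sigma>
    by (induction ts arbitrary: \<sigma>) (simp_all add: toggle_def o_assoc[symmetric])
  from this[of id] show ?thesis by (simp only: position_perm_def o_id)
qed

lemma position_perm_Nil: "position_perm [] = id"
  unfolding position_perm_def by (rule fold_Nil[THEN fun_cong, unfolded id_apply])

lemma position_perm_append: "position_perm (as @ bs) = position_perm as \<circ> position_perm bs"
  using fold_toggle_eq_comp[of bs "position_perm as"]
  by (simp only: position_perm_def fold_append comp_apply)

lemma position_perm_Cons:
  "position_perm (t # ts) = Transposition.transpose t (t + 1) \<circ> position_perm ts"
  unfolding fold_toggle_eq_comp[symmetric]
  by (simp only: position_perm_def fold_simps toggle_def id_comp)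

lemma position_perm_permutes:
  assumes "set ts \<subseteq> {1..<n}"
  shows "position_perm ts permutes {1..n}"
  using assms
proof (induction ts)
  case Nil
  show ?case unfolding position_perm_Nil by (rule permutes_id)
next
  case (Cons t ts)
  have "Transposition.transpose t (t + 1) permutes {1..n}"
    using Cons.prems by (intro permutes_swap_id) auto
  moreover have "position_perm ts permutes {1..n}"
    using Cons by simp
  ultimately show ?case
    unfolding position_perm_Cons by (intro permutes_compose)
qed

text \<open>Composing a cycle with a transposition that joins one of its points \<open>p\<close> to an outside
  fixed point \<open>q\<close> inserts \<open>q\<close> into the cycle between \<open>p\<close> and its successor.\<close>

lemma cyclic_on_insert:
  assumes "cyclic_on d S" "p \<in> S" "q \<notin> S" "d q = q"
  shows "cyclic_on (d \<circ> Transposition.transpose p q) (insert q S)"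
proof -
  define f where "f = d \<circ> Transposition.transpose p q"
  have fp: "f p = q" and fq: "f q = d p"
    using assms by (simp_all add: f_def)
  have fx: "f x = d x" if "x \<in> S" "x \<noteq> p" for x
    using that assms(3) by (auto simp: f_def Transposition.transpose_def)
  have S: "S = orbit d p"
    using assms orbit_cyclic_eq3 by metis
  have q: "q \<in> orbit f p"
    using orbit.base[of f p] fp by simp
  have dp: "d p \<in> orbit f p"
    using orbit.step[OF q] fq by simp
  \<comment> \<open>A step of \<open>d\<close> is a step of \<open>f\<close>, except that the one leaving \<open>p\<close> takes the detour via \<open>q\<close>.\<close>
  have 1: "S \<subseteq> orbit f p"
  proof
    fix y assume "y \<in> S"
    then have "y \<in> orbit d p" using S by simp
    then show "y \<in> orbit f p"
    proof induction
      case base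
      show ?case by (rule dp)
    next
      case (step y)
      then show ?case
        using S dp fx[of y] orbit.step[of y f p] by (cases "y = p") auto
    qed
  qed
  have 2: "orbit f p \<subseteq> insert q S"
  proof
    fix y assume "y \<in> orbit f p"
    then show "y \<in> insert q S"
    proof induction
      case base
      then show ?case using fp by simp
    next
      case (step y)
      have "d x \<in> S" if "x \<in> S" for x
        using cyclic_on_inI[OF assms(1) that] .
      then show ?case
        using step fp fq fx[of y] assms(2) by (cases "y = p"; cases "y = q") auto
    qed
  qed
  have "insert q S = orbit f p" using 1 2 q by blast
  then show ?thesis
    unfolding cyclic_on_def f_def[symmetric] using assms(2) by blast
qed

text \<open>Induction on \<open>n\<close>. The factor \<open>transpose n (n + 1)\<close> sits somewhere inside the product,
  \<open>A \<circ> transpose n (n + 1) \<circ> B\<close>; moving it to the right end past \<open>B\<close> turns it into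
  \<open>transpose p (n + 1)\<close> with \<open>B p = n\<close>. What is left, \<open>A \<circ> B\<close>, is a product of the smaller
  transpositions, hence a cycle on \<open>{1..n}\<close> that fixes \<open>n + 1\<close>.\<close>

lemma cyclic_on_position_perm:
  assumes "n \<ge> 1" "distinct ts" "set ts = {1..<n}"
  shows "cyclic_on (position_perm ts) {1..n}"
  using assms
proof (induction n arbitrary: ts rule: nat_induct_at_least)
  case base
  then have "position_perm ts = id" by (simp add: position_perm_Nil)
  then have "position_perm ts 1 = 1" by simp
  then have "orbit (position_perm ts) 1 = {1}"
    by (simp only: orbit_eq_singleton_iff)
  then show ?case
    by (simp add: cyclic_on_def)
next
  case (Suc n)
  have "n \<in> set ts" using Suc by auto
  then obtain as bs where ts: "ts = as @ n # bs"
    by (meson split_list)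
  define A B where "A = position_perm as" and "B = position_perm bs"
  have "set (as @ bs) = {1..<Suc n} - {n}"
    using Suc.prems(1) unfolding Suc.prems(2)[symmetric] ts by auto
  also have "\<dots> = {1..<n}" by auto
  finally have as_bs: "set (as @ bs) = {1..<n}" "distinct (as @ bs)"
    using Suc.prems(1) by (simp_all add: ts)
  then have bs: "set bs \<subseteq> {1..<n}" by auto
  have B: "B permutes {1..n}"
    unfolding B_def using bs by (rule position_perm_permutes)
  have AB: "position_perm (as @ bs) = A \<circ> B"
    by (simp add: A_def B_def position_perm_append)
  have cyc: "cyclic_on (A \<circ> B) {1..n}"
    using Suc.IH[OF as_bs(2,1)] unfolding AB .
  have "A \<circ> B permutes {1..n}"
    using position_perm_permutes[of "as @ bs" n] as_bs(1) unfolding AB by blast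
  then have fix_last: "(A \<circ> B) (n + 1) = n + 1"
    by (auto simp: permutes_def)
  define p where "p = inv B n"
  have Bp: "B p = n"
    using permutes_inverses(1)[OF B] by (simp add: p_def)
  have p: "p \<in> {1..n}"
    using permutes_in_image[OF permutes_inv[OF B]] Suc.hyps by (simp add: p_def)
  have Bn: "B (n + 1) = n + 1"
    using B by (auto simp: permutes_def)
  have "Transposition.transpose n (n + 1) \<circ> B = B \<circ> Transposition.transpose p (n + 1)"
  proof
    fix x
    have "B x = n \<longleftrightarrow> x = p" "B x = n + 1 \<longleftrightarrow> x = n + 1"
      using permutes_inj[OF B] Bp Bn by (metis injD)+
    then show "(Transposition.transpose n (n + 1) \<circ> B) x
        = (B \<circ> Transposition.transpose p (n + 1)) x"
      using Bp Bn by (simp add: Transposition.transpose_def)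
  qed
  then have "position_perm ts = (A \<circ> B) \<circ> Transposition.transpose p (n + 1)"
    by (simp only: ts position_perm_append position_perm_Cons A_def[symmetric] B_def[symmetric]
        o_assoc[symmetric])
  moreover have "n + 1 \<notin> {1..n}" by simp
  ultimately have "cyclic_on (position_perm ts) (insert (n + 1) {1..n})"
    using cyclic_on_insert[OF cyc p _ fix_last] by metis
  moreover have "insert (n + 1) {1..n} = {1..Suc n}" by auto
  ultimately show ?case by metis
qed

lemma bij_betw_funpow_cyclic_on:
  assumes "cyclic_on c S" "x \<in> S"
  shows "bij_betw (\<lambda>m. (c ^^ m) x) {..<card S} S" and "(c ^^ card S) x = x"
proof -
  let ?N = "funpow_dist1 c x x"
  have S: "orbit c x = S" using orbit_cyclic_eq3[OF assms] .
  then have x: "x \<in> orbit c x" using assms by simp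
  have "bij_betw (\<lambda>m. (c ^^ m) x) {0..<?N} S"
    using inj_on_funpow_dist1[OF x] orbit_conv_funpow_dist1[OF x] S
    by (simp add: bij_betw_def)
  moreover from this have "card S = ?N"
    by (metis bij_betw_same_card card_atLeastLessThan diff_zero)
  ultimately show "bij_betw (\<lambda>m. (c ^^ m) x) {..<card S} S" and "(c ^^ card S) x = x"
    using funpow_dist1_prop[OF x] by (simp_all only: atLeast0LessThan)
qed

section \<open>Homomesy under right multiplication by a long cycle\<close>

lemma homomesic_avg_add:
  assumes "homomesic_avg X \<phi> f a" "homomesic_avg X \<phi> g b"
  shows "homomesic_avg X \<phi> (\<lambda>x. f x + g x) (a + b)"
  using assms by (simp add: homomesic_avg_def sum.distrib add_divide_distrib)

lemma homomesic_avg_cmult: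
  assumes "homomesic_avg X \<phi> f a"
  shows "homomesic_avg X \<phi> (\<lambda>x. r * f x) (r * a)"
  using assms by (auto simp: homomesic_avg_def sum_distrib_left[symmetric])

lemma homomesic_avg_sum:
  assumes "\<And>i. i \<in> I \<Longrightarrow> homomesic_avg X \<phi> (f i) (a i)"
  shows "homomesic_avg X \<phi> (\<lambda>x. \<Sum>i\<in>I. f i x) (\<Sum>i\<in>I. a i)"
  unfolding homomesic_avg_def
proof
  fix \<O> assume "\<O> \<in> orbits \<phi> X"
  then have "1 / real (card \<O>) * (\<Sum>x\<in>\<O>. f i x) = a i" if "i \<in> I" for i
    using assms[OF that] by (simp add: homomesic_avg_def)
  then show "1 / real (card \<O>) * (\<Sum>x\<in>\<O>. \<Sum>i\<in>I. f i x) = (\<Sum>i\<in>I. a i)"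
    by (subst sum.swap) (simp add: sum_distrib_left)
qed

text \<open>The averages depend on the order of the toggles only through the fact that \<open>c\<close> is a single
  cycle on all positions.\<close>

locale long_cycle_action =
  fixes n :: nat and c :: "nat \<Rightarrow> nat" and \<phi> :: "(nat \<Rightarrow> nat) \<Rightarrow> (nat \<Rightarrow> nat)"
  assumes n_pos: "n \<ge> 1"
    and c_permutes: "c permutes {1..n}"
    and c_cyclic: "cyclic_on c {1..n}"
    and \<phi>_eq: "\<phi> \<pi> = \<pi> \<circ> c"
begin

abbreviation hom :: "((nat \<Rightarrow> nat) \<Rightarrow> real) \<Rightarrow> real \<Rightarrow> bool" where
  "hom st a \<equiv> homomesic_avg (perms n) \<phi> st a"

lemma funpow_\<phi>: "(\<phi> ^^ m) \<pi> = \<pi> \<circ> (c ^^ m)"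
proof (induction m)
  case (Suc m)
  then show ?case by (simp add: \<phi>_eq o_assoc[symmetric] funpow_swap1 fun_eq_iff)
qed simp

lemma funpow_c_n: "c ^^ n = id"
proof
  fix x
  show "(c ^^ n) x = id x"
  proof (cases "x \<in> {1..n}")
    case True
    then show ?thesis using bij_betw_funpow_cyclic_on(2)[OF c_cyclic True] by simp
  next
    case False
    then have "c x = x" using c_permutes by (auto simp: permutes_def)
    then have "(c ^^ m) x = x" for m by (induction m) simp_all
    then show ?thesis by simp
  qed
qed

lemma orbit_param:
  assumes "\<O> \<in> orbits \<phi> (perms n)"
  obtains \<pi> where "\<pi> permutes {1..n}" "bij_betw (\<lambda>m. \<pi> \<circ> (c ^^ m)) {..<n} \<O>"
proof -
  from assms obtain \<pi> where \<pi>: "\<pi> permutes {1..n}" and O: "\<O> = {\<pi> \<circ> (c ^^ m) | m. True}"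
    by (auto simp: orbits_def funpow_\<phi>)
  \<comment> \<open>Exponents may be reduced modulo \<open>n\<close>; those below \<open>n\<close> are told apart by the entry in position \<open>1\<close>.\<close>
  have "\<pi> \<circ> (c ^^ m) \<in> (\<lambda>m. \<pi> \<circ> (c ^^ m)) ` {..<n}" for m
  proof -
    have "c ^^ m = c ^^ (m mod n)"
      using funpow_mod_eq[of n c] funpow_c_n by (auto simp: fun_eq_iff)
    then show ?thesis using n_pos by (intro image_eqI[where x = "m mod n"]) auto
  qed
  then have "\<O> = (\<lambda>m. \<pi> \<circ> (c ^^ m)) ` {..<n}" unfolding O by auto
  moreover have "inj_on (\<lambda>m. \<pi> \<circ> (c ^^ m)) {..<n}"
  proof
    fix k m assume km: "k \<in> {..<n}" "m \<in> {..<n}" "\<pi> \<circ> (c ^^ k) = \<pi> \<circ> (c ^^ m)"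
    then have "(c ^^ k) 1 = (c ^^ m) 1"
      using permutes_inj[OF \<pi>] by (metis comp_apply injD)
    moreover have "inj_on (\<lambda>m. (c ^^ m) 1) {..<n}"
      using bij_betw_funpow_cyclic_on(1)[OF c_cyclic, of 1] n_pos by (simp add: bij_betw_def)
    ultimately show "k = m" using km by (auto dest: inj_onD)
  qed
  ultimately show ?thesis using that[OF \<pi>] by (simp add: bij_betw_def)
qed

lemma orbit_subset_perms:
  assumes "\<O> \<in> orbits \<phi> (perms n)"
  shows "\<O> \<subseteq> perms n"
proof -
  have "c ^^ m permutes {1..n}" for m
    by (induction m)
       (simp_all only: funpow.simps permutes_id permutes_compose[OF _ c_permutes])
  with assms show ?thesis
    by (auto simp: orbits_def funpow_\<phi> intro: permutes_compose)
qed

text \<open>Agreement on permutations suffices, since orbits of permutations consist of permutations.\<close>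

lemma hom_cong:
  assumes "hom f a" "\<And>\<pi>. \<pi> permutes {1..n} \<Longrightarrow> g \<pi> = f \<pi>" "b = a"
  shows "hom g b"
  unfolding homomesic_avg_def
proof
  fix \<O> assume O: "\<O> \<in> orbits \<phi> (perms n)"
  have "(\<Sum>x\<in>\<O>. g x) = (\<Sum>x\<in>\<O>. f x)"
    using orbit_subset_perms[OF O] assms(2) by (intro sum.cong) auto
  then show "1 / real (card \<O>) * (\<Sum>x\<in>\<O>. g x) = b"
    using assms(1,3) O by (simp add: homomesic_avg_def)
qed

lemma hom_const: "hom (\<lambda>_. a) a"
  unfolding homomesic_avg_def
proof
  fix \<O> assume "\<O> \<in> orbits \<phi> (perms n)"
  then obtain \<pi> where "bij_betw (\<lambda>m. \<pi> \<circ> (c ^^ m)) {..<n} \<O>" by (rule orbit_param)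
  then have "card \<O> = n" using bij_betw_same_card by fastforce
  then show "1 / real (card \<O>) * (\<Sum>x\<in>\<O>. a) = a" using n_pos by simp
qed

text \<open>The source of all homomesies: along an orbit, the position \<open>i\<close> runs through the whole
  cycle, so the entry in it takes each value of \<open>{1..n}\<close> exactly once.\<close>

lemma hom_entry_fun:
  assumes i: "i \<in> {1..n}"
  shows "hom (\<lambda>\<pi>. f (\<pi> i)) ((\<Sum>j = 1..n. f j) / real n)"
  unfolding homomesic_avg_def
proof
  fix \<O> assume "\<O> \<in> orbits \<phi> (perms n)"
  then obtain \<pi> where \<pi>: "\<pi> permutes {1..n}" and bij: "bij_betw (\<lambda>m. \<pi> \<circ> (c ^^ m)) {..<n} \<O>"
    by (rule orbit_param)
  have card: "card \<O> = n" using bij_betw_same_card[OF bij] by simp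
  have "(\<Sum>x\<in>\<O>. f (x i)) = (\<Sum>m<n. f (\<pi> ((c ^^ m) i)))"
    using sum.reindex_bij_betw[OF bij, of "\<lambda>x. f (x i)"] by simp
  also have "\<dots> = (\<Sum>j = 1..n. f (\<pi> j))"
    using bij_betw_funpow_cyclic_on(1)[OF c_cyclic i]
    by (intro sum.reindex_bij_betw) simp
  also have "\<dots> = (\<Sum>j = 1..n. f j)"
    using sum.permute[OF \<pi>, of f] by (simp add: comp_def)
  finally show "1 / real (card \<O>) * (\<Sum>x\<in>\<O>. f (x i)) = (\<Sum>j = 1..n. f j) / real n"
    using card by simp
qed

text \<open>Linearity over the positions. Summing over each orbit replaces the diagonal expression in
  \<open>\<pi>\<close> by a sum over all position-value pairs.\<close>

lemma hom_weight:
  assumes "(\<Sum>i = 1..n. \<Sum>j = 1..n. w i j) = real n * a"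
  shows "hom (\<lambda>\<pi>. \<Sum>i = 1..n. w i (\<pi> i)) a"
proof -
  have "hom (\<lambda>\<pi>. \<Sum>i = 1..n. w i (\<pi> i)) (\<Sum>i = 1..n. (\<Sum>j = 1..n. w i j) / real n)"
    by (intro homomesic_avg_sum hom_entry_fun)
  then show ?thesis
    using assms n_pos by (simp add: sum_divide_distrib[symmetric])
qed

lemma num_indices_sum: "num_indices n P = (\<Sum>i = 1..n. of_bool (P i))"
  by (simp add: num_indices_def Int_def conj_commute)

lemma hom_num_indices:
  assumes "(\<Sum>i = 1..n. real (card {j \<in> {1..n}. R i j})) = real n * a"
  shows "hom (\<lambda>\<pi>. num_indices n (\<lambda>i. R i (\<pi> i))) a"
proof -
  have "(\<Sum>i = 1..n. \<Sum>j = 1..n. of_bool (R i j)) = real n * a"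
    using assms by (simp add: Int_def conj_commute)
  from hom_weight[of "\<lambda>i j. of_bool (R i j)", OF this]
  show ?thesis by (simp add: num_indices_sum)
qed

lemma homomesic_num_indices: "homomesic (perms n) \<phi> (\<lambda>\<pi>. num_indices n (\<lambda>i. R i (\<pi> i)))"
  unfolding homomesic_def
  by (rule exI, rule hom_num_indices[where a = "(\<Sum>i = 1..n. real (card {j \<in> {1..n}. R i j})) / real n"])
     (use n_pos in simp)

lemma hom_num_indices_not:
  assumes "hom (\<lambda>\<pi>. num_indices n (P \<pi>)) a" "b = real n - a"
  shows "hom (\<lambda>\<pi>. num_indices n (\<lambda>i. \<not> P \<pi> i)) b"
proof -
  have "hom (\<lambda>\<pi>. real n + (- 1) * num_indices n (P \<pi>)) (real n + (- 1) * a)"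
    by (intro homomesic_avg_add homomesic_avg_cmult hom_const assms)
  then show ?thesis
    by (rule hom_cong) (simp_all add: assms num_indices_sum of_bool_not_iff sum_subtractf)
qed

lemma hom_num_indices_disj:
  assumes "hom (\<lambda>\<pi>. num_indices n (P \<pi>)) a" "hom (\<lambda>\<pi>. num_indices n (Q \<pi>)) b"
    and "\<And>\<pi> i. \<not> (P \<pi> i \<and> Q \<pi> i)"
  shows "hom (\<lambda>\<pi>. num_indices n (\<lambda>i. P \<pi> i \<or> Q \<pi> i)) (a + b)"
proof (rule hom_cong[OF homomesic_avg_add[OF assms(1,2)]])
  fix \<pi>
  have "of_bool (P \<pi> i \<or> Q \<pi> i) = (of_bool (P \<pi> i) + of_bool (Q \<pi> i) :: real)" for i
    using assms(3)[of \<pi> i] by auto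
  then show "num_indices n (\<lambda>i. P \<pi> i \<or> Q \<pi> i) = num_indices n (P \<pi>) + num_indices n (Q \<pi>)"
    by (simp only: num_indices_sum sum.distrib)
qed simp


end

section \<open>Sums and counts over \<open>{1..n}\<close> and its square\<close>

lemma sum_real_atLeastAtMost: "(\<Sum>i = 1..n. real i) = real n * (real n + 1) / 2"
  by (induction n) (auto simp: field_simps)

lemmas sum_real_Suc_0_atMost = sum_real_atLeastAtMost[unfolded One_nat_def]

lemma sum_squares_atLeastAtMost:
  "(\<Sum>i = 1..n. (real i)\<^sup>2) = real n * (real n + 1) * (2 * real n + 1) / 6"
  by (induction n) (auto simp: field_simps power2_eq_square)

lemma real_choose_3: "real ((n + 1) choose 3) = (real n + 1) * real n * (real n - 1) / 6"
proof (cases "n \<ge> 2")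
  case True
  then show ?thesis
    by (simp add: binomial_gbinomial gbinomial_prod_rev numeral_3_eq_3 lessThan_Suc of_nat_diff
        field_simps)
next
  case False
  then have "n = 0 \<or> n = 1" by auto
  then show ?thesis by auto
qed

lemma sum_upper_differences:
  "(\<Sum>i = 1..n. \<Sum>j = 1..n. if i < j then real j - real i else 0) = real ((n + 1) choose 3)"
proof -
  have "(\<Sum>i = 1..n. \<Sum>j = 1..n. if i < j then real j - real i else 0)
      = (real n + 1) * real n * (real n - 1) / 6"
  proof (induction n)
    case (Suc n)
    have "(\<Sum>i = 1..n. if i < Suc n then real (Suc n) - real i else 0)
        = (\<Sum>i = 1..n. real (Suc n) - real i)"
      by (intro sum.cong) auto
    also have "\<dots> = real n * (real n + 1) / 2"
      unfolding sum_subtractf sum_real_atLeastAtMost by (simp add: field_simps)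
    finally have new: "(\<Sum>i = 1..n. if i < Suc n then real (Suc n) - real i else 0)
        = real n * (real n + 1) / 2" .
    have "(\<Sum>j = 1..Suc n. if Suc n < j then real j - real (Suc n) else 0) = 0"
      by (intro sum.neutral) auto
    then have "(\<Sum>i = 1..Suc n. \<Sum>j = 1..Suc n. if i < j then real j - real i else 0)
        = (\<Sum>i = 1..n. (\<Sum>j = 1..n. if i < j then real j - real i else 0)
             + (if i < Suc n then real (Suc n) - real i else 0))"
      by simp
    also have "\<dots> = (real n + 1) * real n * (real n - 1) / 6 + real n * (real n + 1) / 2"
      unfolding sum.distrib Suc.IH new ..
    finally show ?case by (simp add: field_simps)
  qed simp
  then show ?thesis by (simp only: real_choose_3)
qed

lemma sum_lower_differences:
  "(\<Sum>i = 1..n. \<Sum>j = 1..n. if j < i then real i - real j else 0) = real ((n + 1) choose 3)"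
  by (subst sum.swap) (rule sum_upper_differences)

lemma sum_inverse_eq_harm_diff: "(\<Sum>i = 1..n. 1 / (real k + real i)) = harm (k + n) - harm k"
  by (induction n) (simp_all add: harm_Suc inverse_eq_divide add_ac)

text \<open>Passing from \<open>n\<close> to \<open>n + 1\<close> adds a column and a row to the square, whose contributions
  are differences of harmonic numbers.\<close>

lemma sum_inverse_sums:
  "(\<Sum>i = 1..n. \<Sum>j = 1..n. 1 / (real i + real j))
     = (2 * real n + 1) * harm (2 * n) - (2 * real n + 2) * harm n"
proof (induction n)
  case (Suc n)
  have "Suc n + n = 2 * n + 1" "Suc n + Suc n = 2 * n + 2" by simp_all
  then have row: "(\<Sum>j = 1..Suc n. 1 / (real (Suc n) + real j)) = harm (2 * n + 2) - harm (n + 1)"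
    and "(\<Sum>i = 1..n. 1 / (real (Suc n) + real i)) = harm (2 * n + 1) - harm (n + 1)"
    using sum_inverse_eq_harm_diff[of "Suc n" n] sum_inverse_eq_harm_diff[of "Suc n" "Suc n"]
    by (simp_all only: Suc_eq_plus1)
  then have col: "(\<Sum>i = 1..n. 1 / (real i + real (Suc n))) = harm (2 * n + 1) - harm (n + 1)"
    by (simp only: add.commute[of _ "real (Suc n)"])
  have "(\<Sum>i = 1..Suc n. \<Sum>j = 1..Suc n. 1 / (real i + real j))
      = (\<Sum>i = 1..n. \<Sum>j = 1..n. 1 / (real i + real j))
        + (\<Sum>i = 1..n. 1 / (real i + real (Suc n)))
        + (\<Sum>j = 1..Suc n. 1 / (real (Suc n) + real j))"
    by (simp add: sum.distrib)
  also have "\<dots> = (2 * real n + 1) * harm (2 * n) - (2 * real n + 2) * harm n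
        + (harm (2 * n + 1) - harm (n + 1)) + (harm (2 * n + 2) - harm (n + 1))"
    unfolding Suc.IH col row ..
  also have "\<dots> = (2 * real (Suc n) + 1) * harm (2 * Suc n) - (2 * real (Suc n) + 2) * harm (Suc n)"
  proof -
    define a b e where "a = 1 / (2 * real n + 1)" and "b = 1 / (real n + 1)"
      and "e = 1 / (2 * real n + 2)"
    have nz: "2 * real n + 1 \<noteq> 0" "real n + 1 \<noteq> 0" "2 * real n + 2 \<noteq> 0"
      by linarith+
    then have abe: "(2 * real n + 1) * a = 1" "(real n + 1) * b = 1" "(2 * real n + 2) * e = 1"
      by (simp_all add: a_def b_def e_def)
    have 1: "harm (2 * n + 1) = harm (2 * n) + a" and 2: "harm (n + 1) = harm n + b"
      using harm_Suc[of "2 * n", where ?'a = real] harm_Suc[of n, where ?'a = real]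
      by (simp_all add: a_def b_def inverse_eq_divide add_ac)
    have 3: "harm (2 * n + 2) = harm (2 * n) + a + e"
      using harm_Suc[of "2 * n + 1", where ?'a = real] 1
      by (simp add: e_def inverse_eq_divide add_ac)
    have "2 * Suc n = 2 * n + 2" "real (Suc n) = real n + 1" by simp_all
    then show ?thesis
      unfolding Suc_eq_plus1 using abe by (simp only: 1 2 3) (simp add: algebra_simps)
  qed
  finally show ?case .
qed (simp add: harm_expand)

lemma card_odd_shift:
  "card {j \<in> {1..n}. odd (i + j)} = (if odd i then n div 2 else (n + 1) div 2)"
proof (induction n)
  case (Suc n)
  have "{j \<in> {1..Suc n}. odd (i + j)}
      = {j \<in> {1..n}. odd (i + j)} \<union> (if odd (i + Suc n) then {Suc n} else {})"
    by (auto simp: le_Suc_eq)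
  then show ?case
    using Suc.IH by (auto simp: card_insert_if elim!: oddE evenE)
qed simp

lemma sum_if_odd:
  "(\<Sum>i = 1..n. if odd i then a else b) = real ((n + 1) div 2) * a + real (n div 2) * b"
  by (induction n) (auto simp: algebra_simps elim!: oddE evenE)

text \<open>Taking \<open>n + 1\<close> out of the odd terms leaves the alternating sum \<open>-1 + 2 - 3 + \<dots>\<close>, which has a
  closed form for each parity of \<open>n\<close>.\<close>

lemma sum_even_or_complement:
  "(\<Sum>i = 1..n. if even i then real i else real n + 1 - real i) = real n * real ((n + 2) div 2)"
proof -
  have alt: "(\<Sum>i = 1..n. if even i then real i else - real i)
      = (if even n then real n / 2 else - (real n + 1) / 2)"
    by (induction n) (auto simp: field_simps)
  have "(\<Sum>i = 1..n. if even i then real i else real n + 1 - real i)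
      = (\<Sum>i = 1..n. (if even i then real i else - real i) + (if odd i then real n + 1 else 0))"
    by (intro sum.cong) auto
  also have "\<dots> = real n * real ((n + 2) div 2)"
    unfolding sum.distrib alt sum_if_odd by (auto elim!: oddE evenE simp: field_simps)
  finally show ?thesis .
qed

lemma card_residue_class:
  fixes n a :: nat
  assumes "n \<ge> 1"
  shows "card {j \<in> {1..n}. [j = a] (mod n)} = 1"
proof -
  \<comment> \<open>The class of \<open>0\<close> is represented by \<open>n\<close>, because the range starts at \<open>1\<close>.\<close>
  define r where "r = (if a mod n = 0 then n else a mod n)"
  have "r \<in> {1..n}" "[r = a] (mod n)"
    using assms mod_less_divisor[of n a] by (auto simp: r_def cong_def intro: less_imp_le)
  moreover have "j = r" if "j \<in> {1..n}" "[j = a] (mod n)" for j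
    using that by (cases "j = n") (auto simp: r_def cong_def)
  ultimately have "{j \<in> {1..n}. [j = a] (mod n)} = {r}" by blast
  then show ?thesis by simp
qed

section \<open>The inversion sum\<close>

lemma sum_sgn_differences:
  assumes "k \<in> {1..n}"
  shows "(\<Sum>i = 1..n. sgn (real k - real i)) = 2 * real k - real n - 1"
proof -
  have "(\<Sum>i = 1..n. sgn (real k - real i))
      = (\<Sum>i = 1..n. of_bool (i < k) - of_bool (k < i))"
    by (intro sum.cong) (auto simp: sgn_if)
  also have "\<dots> = real (card {1..<k}) - real (card {k<..n})"
  proof -
    have "{1..n} \<inter> {i. i < k} = {1..<k}" "{1..n} \<inter> {i. k < i} = {k<..n}"
      using assms by auto
    then show ?thesis by (simp add: sum_subtractf)
  qed
  finally show ?thesis using assms by (simp add: of_nat_diff)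
qed

lemma sum_double_inversions:
  "(\<Sum>(i, j)\<in>{(i, j). i \<in> {1..n} \<and> j \<in> {1..n} \<and> i < j \<and> P i j}. real j - real i)
     = (\<Sum>i = 1..n. \<Sum>j = 1..n. if i < j \<and> P i j then real j - real i else 0)"
proof -
  have "{(i, j). i \<in> {1..n} \<and> j \<in> {1..n} \<and> i < j \<and> P i j}
      = {z \<in> {1..n} \<times> {1..n}. fst z < snd z \<and> P (fst z) (snd z)}"
    by auto
  moreover have "(\<Sum>z\<in>{z \<in> {1..n} \<times> {1..n}. fst z < snd z \<and> P (fst z) (snd z)}.
        real (snd z) - real (fst z))
      = (\<Sum>z\<in>{1..n} \<times> {1..n}. if fst z < snd z \<and> P (fst z) (snd z)
           then real (snd z) - real (fst z) else 0)"
    by (rule sum.inter_filter) simp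
  ultimately show ?thesis
    by (simp add: sum.cartesian_product case_prod_unfold)
qed

lemma inversion_sum_plus_non_inversion_sum:
  assumes "\<pi> permutes {1..n}"
  shows "inversion_sum n \<pi> + non_inversion_sum n \<pi> = real ((n + 1) choose 3)"
proof -
  have "inversion_sum n \<pi> + non_inversion_sum n \<pi>
      = (\<Sum>i = 1..n. \<Sum>j = 1..n. (if i < j \<and> \<pi> j < \<pi> i then real j - real i else 0)
           + (if i < j \<and> \<pi> i < \<pi> j then real j - real i else 0))"
    unfolding inversion_sum_def non_inversion_sum_def inversions_def non_inversions_def
      sum_double_inversions sum.distrib ..
  also have "\<dots> = (\<Sum>i = 1..n. \<Sum>j = 1..n. if i < j then real j - real i else 0)"
  proof (intro sum.cong refl)
    fix i j
    have "\<pi> i = \<pi> j \<longleftrightarrow> i = j" using permutes_inj[OF assms] by (auto dest: injD)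
    then show "(if i < j \<and> \<pi> j < \<pi> i then real j - real i else 0)
        + (if i < j \<and> \<pi> i < \<pi> j then real j - real i else 0)
        = (if i < j then real j - real i else 0)"
      by auto
  qed
  finally show ?thesis by (simp only: sum_upper_differences)
qed

text \<open>The difference is the sum of \<open>(j - i) * sgn (\<pi> j - \<pi> i)\<close> over all \<open>i < j\<close>. The summand is
  symmetric in \<open>i\<close> and \<open>j\<close>, so this is half the sum over all pairs, and there each \<open>j\<close> gets the
  coefficient \<open>\<Sum>i. sgn (\<pi> j - \<pi> i)\<close>. It depends on \<open>\<pi> j\<close> only: \<open>\<pi> j - 1\<close> entries are smaller and
  \<open>n - \<pi> j\<close> are larger.\<close>

lemma non_inversion_sum_minus_inversion_sum:
  assumes "\<pi> permutes {1..n}"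
  shows "non_inversion_sum n \<pi> - inversion_sum n \<pi>
    = (\<Sum>j = 1..n. real j * (2 * real (\<pi> j) - real n - 1))"
proof -
  define s where "s i j = sgn (real (\<pi> j) - real (\<pi> i))" for i j
  have s_swap: "s j i = - s i j" for i j
    by (simp add: s_def sgn_if)
  define D where "D = non_inversion_sum n \<pi> - inversion_sum n \<pi>"
  have D: "D = (\<Sum>i = 1..n. \<Sum>j = 1..n. if i < j then (real j - real i) * s i j else 0)"
    unfolding D_def inversion_sum_def non_inversion_sum_def inversions_def non_inversions_def
      sum_double_inversions sum_subtractf[symmetric]
    by (intro sum.cong) (auto simp: s_def sgn_if)
  also have "\<dots> = (\<Sum>i = 1..n. \<Sum>j = 1..n. if j < i then (real j - real i) * s i j else 0)"
  proof (subst sum.swap, intro sum.cong refl)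
    fix i j
    have "(real i - real j) * s j i = (real j - real i) * s i j"
      by (subst s_swap) (simp add: algebra_simps)
    then show "(if j < i then (real i - real j) * s j i else 0)
        = (if j < i then (real j - real i) * s i j else 0)"
      by simp
  qed
  finally have D': "D = \<dots>" .
  have "2 * D = (\<Sum>i = 1..n. \<Sum>j = 1..n. (if i < j then (real j - real i) * s i j else 0)
      + (if j < i then (real j - real i) * s i j else 0))"
    unfolding sum.distrib D[symmetric] D'[symmetric] by simp
  also have "\<dots> = (\<Sum>i = 1..n. \<Sum>j = 1..n. real j * s i j + real i * s j i)"
  proof (intro sum.cong refl)
    fix i j
    have "(if i < j then (real j - real i) * s i j else 0)
        + (if j < i then (real j - real i) * s i j else 0) = (real j - real i) * s i j"
      by auto
    also have "\<dots> = real j * s i j + real i * s j i"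
      by (simp add: s_swap[of i j] algebra_simps)
    finally show "(if i < j then (real j - real i) * s i j else 0)
        + (if j < i then (real j - real i) * s i j else 0) = real j * s i j + real i * s j i" .
  qed
  also have "\<dots> = 2 * (\<Sum>j = 1..n. real j * (\<Sum>i = 1..n. s i j))"
    unfolding sum.distrib sum_distrib_left[symmetric]
    by (subst sum.swap) (simp add: sum_distrib_left)
  also have "(\<Sum>j = 1..n. real j * (\<Sum>i = 1..n. s i j))
      = (\<Sum>j = 1..n. real j * (2 * real (\<pi> j) - real n - 1))"
  proof (rule sum.cong[OF refl])
    fix j assume "j \<in> {1..n}"
    then have "\<pi> j \<in> {1..n}" using permutes_in_image[OF assms] by blast
    moreover have "(\<Sum>i = 1..n. s i j) = (\<Sum>k = 1..n. sgn (real (\<pi> j) - real k))"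
      unfolding s_def
      using sum.permute[OF assms, of "\<lambda>k. sgn (real (\<pi> j) - real k)"] by (simp add: comp_def)
    ultimately show "real j * (\<Sum>i = 1..n. s i j) = real j * (2 * real (\<pi> j) - real n - 1)"
      by (simp only: sum_sgn_differences)
  qed
  finally show ?thesis unfolding D_def by simp
qed

section \<open>The statistics\<close>

context long_cycle_action
begin

lemma hom_entry:
  assumes "i \<in> {1..n}"
  shows "hom (\<lambda>\<pi>. real (\<pi> i)) ((real n + 1) / 2)"
  by (rule hom_cong[OF hom_entry_fun[OF assms, of real]])
     (use n_pos in \<open>simp_all only: sum_real_atLeastAtMost, simp_all\<close>)

lemma hom_k_excedance:
  assumes "k \<in> {1..n}"
  shows "hom (\<lambda>\<pi>. num_indices n (k_excedance k \<pi>)) ((real n - real k) / real n)"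
  unfolding k_excedance_def[abs_def]
proof (rule hom_num_indices)
  have "{j \<in> {1..n}. j = i + k} = (if i + k \<le> n then {i + k} else {})" for i
    using assms by auto
  then have "(\<Sum>i = 1..n. real (card {j \<in> {1..n}. j = i + k})) = (\<Sum>i = 1..n. of_bool (i + k \<le> n))"
    by (intro sum.cong) auto
  also have "\<dots> = real (card {1..n - k})"
  proof -
    have "{1..n} \<inter> {i. i + k \<le> n} = {1..n - k}" using assms by auto
    then show ?thesis by simp
  qed
  finally show "(\<Sum>i = 1..n. real (card {j \<in> {1..n}. j = i + k})) = real n * ((real n - real k) / real n)"
    using assms by (simp add: of_nat_diff)
qed

lemma hom_small_excedance: "hom (\<lambda>\<pi>. num_indices n (small_excedance \<pi>)) ((real n - 1) / real n)"
  using hom_k_excedance[of 1] n_pos by (simp add: k_excedance_def[abs_def] small_excedance_def[abs_def])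

lemma hom_cyclical_k_excedance: "hom (\<lambda>\<pi>. num_indices n (cyclical_k_excedance n k \<pi>)) 1"
  unfolding cyclical_k_excedance_def[abs_def]
  by (rule hom_num_indices) (simp add: card_residue_class[OF n_pos, simplified])

lemma hom_cyclical_small_excedance: "hom (\<lambda>\<pi>. num_indices n (cyclical_small_excedance n \<pi>)) 1"
  using hom_cyclical_k_excedance[of 1]
  by (simp add: cyclical_k_excedance_def[abs_def] cyclical_small_excedance_def[abs_def])

lemma hom_fixed_point: "hom (\<lambda>\<pi>. num_indices n (fixed_point \<pi>)) 1"
  unfolding fixed_point_def[abs_def]
proof (rule hom_num_indices)
  have "card {j \<in> {1..n}. j = i} = 1" if "i \<in> {1..n}" for i
  proof -
    have "{j \<in> {1..n}. j = i} = {i}" using that by auto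
    then show ?thesis by simp
  qed
  then show "(\<Sum>i = 1..n. real (card {j \<in> {1..n}. j = i})) = real n * 1"
    by simp
qed

lemma hom_cyclical_small_weak_excedance:
  assumes "2 \<le> n"
  shows "hom (\<lambda>\<pi>. num_indices n (cyclical_small_weak_excedance n \<pi>)) 2"
proof -
  have "\<not> [i = i + 1] (mod n)" for i
    using assms cong_add_lcancel_0_nat[of i 1 n]
    by (auto simp: cong_sym_eq[of i] cong_0_iff)
  then have "\<not> (fixed_point \<pi> i \<and> cyclical_small_excedance n \<pi> i)" for \<pi> i
    by (auto simp: fixed_point_def cyclical_small_excedance_def)
  from hom_num_indices_disj[OF hom_fixed_point hom_cyclical_small_excedance this]
  show ?thesis
    by (simp add: fixed_point_def cyclical_small_excedance_def
        cyclical_small_weak_excedance_def[abs_def])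
qed

lemma hom_small_weak_excedance:
  "hom (\<lambda>\<pi>. num_indices n (small_weak_excedance \<pi>)) (1 + (real n - 1) / real n)"
proof -
  have "\<not> (fixed_point \<pi> i \<and> small_excedance \<pi> i)" for \<pi> i
    by (auto simp: fixed_point_def small_excedance_def)
  from hom_num_indices_disj[OF hom_fixed_point hom_small_excedance this]
  show ?thesis
    by (simp add: fixed_point_def small_excedance_def small_weak_excedance_def[abs_def])
qed

lemma hom_deficiency: "hom (\<lambda>\<pi>. num_indices n (deficiency \<pi>)) ((real n - 1) / 2)"
  unfolding deficiency_def[abs_def]
proof (rule hom_num_indices)
  have "card {j \<in> {1..n}. j < i} = i - 1" if "i \<in> {1..n}" for i
  proof -
    have "{j \<in> {1..n}. j < i} = {1..<i}" using that by auto
    then show ?thesis by simp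
  qed
  then have "(\<Sum>i = 1..n. real (card {j \<in> {1..n}. j < i})) = (\<Sum>i = 1..n. real i - 1)"
    by (intro sum.cong) (auto simp: of_nat_diff)
  then show "(\<Sum>i = 1..n. real (card {j \<in> {1..n}. j < i})) = real n * ((real n - 1) / 2)"
    by (simp add: sum_subtractf sum_real_Suc_0_atMost field_simps)
qed

lemma hom_excedance: "hom (\<lambda>\<pi>. num_indices n (excedance \<pi>)) ((real n - 1) / 2)"
  unfolding excedance_def[abs_def]
proof (rule hom_num_indices)
  have "card {j \<in> {1..n}. i < j} = n - i" for i
  proof -
    have "{j \<in> {1..n}. i < j} = {i<..n}" by auto
    then show ?thesis by simp
  qed
  then have "(\<Sum>i = 1..n. real (card {j \<in> {1..n}. i < j})) = (\<Sum>i = 1..n. real n - real i)"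
    by (intro sum.cong) (auto simp: of_nat_diff)
  then show "(\<Sum>i = 1..n. real (card {j \<in> {1..n}. i < j})) = real n * ((real n - 1) / 2)"
    by (simp add: sum_subtractf sum_real_Suc_0_atMost field_simps)
qed

lemma hom_weak_excedance: "hom (\<lambda>\<pi>. num_indices n (weak_excedance \<pi>)) ((real n + 1) / 2)"
proof -
  have "weak_excedance \<pi> = (\<lambda>i. \<not> deficiency \<pi> i)" for \<pi>
    by (auto simp: weak_excedance_def deficiency_def not_less)
  then show ?thesis
    using hom_num_indices_not[OF hom_deficiency refl] by (simp add: field_simps)
qed

lemma hom_weak_deficiency: "hom (\<lambda>\<pi>. num_indices n (weak_deficiency \<pi>)) ((real n + 1) / 2)"
proof -
  have "weak_deficiency \<pi> = (\<lambda>i. \<not> excedance \<pi> i)" for \<pi>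
    by (auto simp: weak_deficiency_def excedance_def not_less)
  then show ?thesis
    using hom_num_indices_not[OF hom_excedance refl] by (simp add: field_simps)
qed

text \<open>Big excedances are the excedances that are not small.\<close>

lemma hom_big_excedance:
  "hom (\<lambda>\<pi>. num_indices n (big_excedance \<pi>)) ((real n - 1) * (real n - 2) / (2 * real n))"
proof (rule hom_cong)
  show "hom (\<lambda>\<pi>. num_indices n (excedance \<pi>) + (- 1) * num_indices n (small_excedance \<pi>))
      ((real n - 1) / 2 + (- 1) * ((real n - 1) / real n))"
    by (intro homomesic_avg_add homomesic_avg_cmult hom_excedance hom_small_excedance)
  fix \<pi>
  show "num_indices n (big_excedance \<pi>)
      = num_indices n (excedance \<pi>) + (- 1) * num_indices n (small_excedance \<pi>)"
    unfolding num_indices_sum sum_distrib_left sum.distrib[symmetric]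
    by (intro sum.cong) (auto simp: big_excedance_def excedance_def small_excedance_def)
qed (use n_pos in \<open>simp add: field_simps\<close>)

lemma hom_big_deficiency:
  "hom (\<lambda>\<pi>. num_indices n (big_deficiency \<pi>)) ((real n - 1) * (real n - 2) / (2 * real n))"
  unfolding big_deficiency_def[abs_def]
proof (rule hom_num_indices)
  have "card {j \<in> {1..n}. int j < int i - 1} = i - 2" if "i \<in> {1..n}" for i
  proof -
    have "{j \<in> {1..n}. int j < int i - 1} = {1..<i - 1}" using that by auto
    then show ?thesis by simp
  qed
  then have "(\<Sum>i = 1..n. real (card {j \<in> {1..n}. int j < int i - 1}))
      = (\<Sum>i = 1..n. real i - 2 + of_bool (i = 1))"
    \<comment> \<open>The correction at \<open>i = 1\<close> accounts for the truncated difference \<open>i - 2\<close>.\<close>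
    by (intro sum.cong) (auto simp: of_nat_diff)
  also have "\<dots> = (\<Sum>i = 1..n. real i) - 2 * real n + 1"
    using n_pos by (simp add: sum.distrib sum_subtractf Int_def of_bool_def)
  also have "\<dots> = real n * ((real n - 1) * (real n - 2) / (2 * real n))"
    unfolding sum_real_atLeastAtMost using n_pos by (simp add: field_simps)
  finally show "(\<Sum>i = 1..n. real (card {j \<in> {1..n}. int j < int i - 1}))
      = real n * ((real n - 1) * (real n - 2) / (2 * real n))" .
qed

lemma hom_even_weak_deficiency_odd_weak_excedance:
  "hom (\<lambda>\<pi>. num_indices n (\<lambda>i. even i \<and> \<pi> i \<le> i) + num_indices n (\<lambda>i. odd i \<and> \<pi> i \<ge> i))
     (real_of_int \<lfloor>(real n + 2) / 2\<rfloor>)"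
proof -
  have "card {j \<in> {1..n}. even i \<and> j \<le> i \<or> odd i \<and> j \<ge> i} = (if even i then i else n + 1 - i)"
    if "i \<in> {1..n}" for i
  proof -
    have "{j \<in> {1..n}. even i \<and> j \<le> i \<or> odd i \<and> j \<ge> i} = (if even i then {1..i} else {i..n})"
      using that by auto
    then show ?thesis by simp
  qed
  then have "(\<Sum>i = 1..n. real (card {j \<in> {1..n}. even i \<and> j \<le> i \<or> odd i \<and> j \<ge> i}))
      = (\<Sum>i = 1..n. if even i then real i else real n + 1 - real i)"
    by (intro sum.cong) (auto simp: of_nat_diff)
  also have "\<dots> = real n * real ((n + 2) div 2)"
    by (rule sum_even_or_complement)
  also have "real ((n + 2) div 2) = real_of_int \<lfloor>(real n + 2) / 2\<rfloor>"
    using floor_divide_of_nat_eq[of "n + 2" 2, where ?'a = real] by (simp add: add.commute)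
  finally have "hom (\<lambda>\<pi>. num_indices n (\<lambda>i. even i \<and> \<pi> i \<le> i \<or> odd i \<and> \<pi> i \<ge> i))
      (real_of_int \<lfloor>(real n + 2) / 2\<rfloor>)"
    by (rule hom_num_indices)
  then show ?thesis
  proof (rule hom_cong)
    fix \<pi>
    show "num_indices n (\<lambda>i. even i \<and> \<pi> i \<le> i) + num_indices n (\<lambda>i. odd i \<and> \<pi> i \<ge> i)
        = num_indices n (\<lambda>i. even i \<and> \<pi> i \<le> i \<or> odd i \<and> \<pi> i \<ge> i)"
      unfolding num_indices_sum sum.distrib[symmetric] by (intro sum.cong) auto
  qed simp
qed

lemma hom_depth: "hom (depth n) (1 / real n * real ((n + 1) choose 3))"
proof (rule hom_cong[OF hom_weight])
  show "(\<Sum>i = 1..n. \<Sum>j = 1..n. if i < j then real j - real i else 0)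
      = real n * (1 / real n * real ((n + 1) choose 3))"
    using n_pos by (simp only: sum_upper_differences) simp
  fix \<pi>
  show "depth n \<pi> = (\<Sum>i = 1..n. if i < \<pi> i then real (\<pi> i) - real i else 0)"
    unfolding depth_def using sum.inter_filter[of "{1..n}" "\<lambda>i. real (\<pi> i) - real i" "\<lambda>i. i < \<pi> i"]
    by simp
qed simp

lemma hom_total_displacement:
  "hom (total_displacement n) (2 / real n * real ((n + 1) choose 3))"
proof (rule hom_cong[OF hom_weight])
  have "(\<Sum>i = 1..n. \<Sum>j = 1..n. \<bar>real j - real i\<bar>)
      = (\<Sum>i = 1..n. \<Sum>j = 1..n. (if i < j then real j - real i else 0)
          + (if j < i then real i - real j else 0))"
    by (intro sum.cong) auto
  also have "\<dots> = 2 * real ((n + 1) choose 3)"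
    unfolding sum.distrib sum_upper_differences sum_lower_differences by simp
  finally show "(\<Sum>i = 1..n. \<Sum>j = 1..n. \<bar>real j - real i\<bar>)
      = real n * (2 / real n * real ((n + 1) choose 3))"
    using n_pos by simp
qed (simp_all add: total_displacement_def)

lemma hom_index_times_entry:
  "hom (\<lambda>\<pi>. \<Sum>i = 1..n. real i * real (\<pi> i)) ((real n + 1)\<^sup>2 * real n / 4)"
proof (rule hom_weight)
  have "(\<Sum>i = 1..n. \<Sum>j = 1..n. real i * real j) = (\<Sum>i = 1..n. real i) * (\<Sum>j = 1..n. real j)"
    by (rule sum_product[symmetric])
  then show "(\<Sum>i = 1..n. \<Sum>j = 1..n. real i * real j) = real n * ((real n + 1)\<^sup>2 * real n / 4)"
    unfolding sum_real_atLeastAtMost by (simp add: power2_eq_square)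
qed

lemma hom_squared_displacement:
  "hom (\<lambda>\<pi>. \<Sum>i = 1..n. (real (\<pi> i) - real i)\<^sup>2) (real ((n + 1) choose 3))"
proof (rule hom_weight)
  have "(\<Sum>i = 1..n. \<Sum>j = 1..n. (real j - real i)\<^sup>2)
      = (\<Sum>i = 1..n. \<Sum>j = 1..n. (real j)\<^sup>2 + (real i)\<^sup>2 - 2 * (real i * real j))"
    by (intro sum.cong refl) (simp add: power2_diff)
  also have "\<dots> = 2 * real n * (\<Sum>i = 1..n. (real i)\<^sup>2) - 2 * (\<Sum>i = 1..n. real i)\<^sup>2"
    by (simp add: sum.distrib sum_subtractf sum_distrib_left[symmetric] sum_distrib_right[symmetric]
        power2_eq_square)
  also have "\<dots> = real n * real ((n + 1) choose 3)"
    unfolding sum_squares_atLeastAtMost sum_real_atLeastAtMost real_choose_3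
    by (simp add: field_simps power2_eq_square)
  finally show "(\<Sum>i = 1..n. \<Sum>j = 1..n. (real j - real i)\<^sup>2) = real n * real ((n + 1) choose 3)" .
qed

lemma hom_non_inversion_sum_minus_inversion_sum:
  "hom (\<lambda>\<pi>. non_inversion_sum n \<pi> - inversion_sum n \<pi>) 0"
proof (rule hom_cong[OF hom_weight])
  have "(\<Sum>j = 1..n. 2 * real j - real n - 1) = 0"
    unfolding sum_subtractf sum_distrib_left[symmetric] sum_real_atLeastAtMost
    by (simp add: algebra_simps)
  then show "(\<Sum>i = 1..n. \<Sum>j = 1..n. real i * (2 * real j - real n - 1)) = real n * 0"
    by (simp only: sum_distrib_left[symmetric]) simp
qed (simp_all add: non_inversion_sum_minus_inversion_sum)

text \<open>The inversion sum is half the difference of the constant sum and the homomesic difference;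
  adding that difference back gives the non-inversion sum.\<close>

lemma hom_inversion_sum: "hom (inversion_sum n) (1 / 2 * real ((n + 1) choose 3))"
proof (rule hom_cong)
  show "inversion_sum n \<pi> = 1 / 2 * real ((n + 1) choose 3)
      + (- 1 / 2) * (non_inversion_sum n \<pi> - inversion_sum n \<pi>)"
    if "\<pi> permutes {1..n}" for \<pi>
    using inversion_sum_plus_non_inversion_sum[OF that] by argo
  show "hom (\<lambda>\<pi>. 1 / 2 * real ((n + 1) choose 3)
        + (- 1 / 2) * (non_inversion_sum n \<pi> - inversion_sum n \<pi>))
      (1 / 2 * real ((n + 1) choose 3) + (- 1 / 2) * 0)"
    by (intro homomesic_avg_add homomesic_avg_cmult hom_const
        hom_non_inversion_sum_minus_inversion_sum)
qed simp

lemma hom_non_inversion_sum: "hom (non_inversion_sum n) (1 / 2 * real ((n + 1) choose 3))"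
  by (rule hom_cong[OF homomesic_avg_add[OF hom_inversion_sum
          hom_non_inversion_sum_minus_inversion_sum]]) simp_all

lemma hom_reciprocal_sums:
  "hom (\<lambda>\<pi>. L * (\<Sum>i = 1..n. 1 / (real i + real (\<pi> i))))
     (L / real n * ((2 * real n + 1) * harm (2 * n) - (2 * real n + 2) * harm n))"
proof (rule hom_cong[OF homomesic_avg_cmult[where r = L, OF hom_weight]])
  let ?S = "(2 * real n + 1) * harm (2 * n) - (2 * real n + 2) * harm n"
  show "(\<Sum>i = 1..n. \<Sum>j = 1..n. 1 / (real i + real j)) = real n * (?S / real n)"
    unfolding sum_inverse_sums using n_pos by simp
qed simp_all

lemma hom_half_odd_sums:
  "hom (\<lambda>\<pi>. 1 / 2 * num_indices n (\<lambda>i. odd (i + \<pi> i)))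
     (1 / real n * real_of_int \<lfloor>real n / 2\<rfloor> * real_of_int \<lceil>real n / 2\<rceil>)"
proof (rule hom_cong[OF homomesic_avg_cmult[OF hom_num_indices]])
  define a where "a = 2 / real n * real (n div 2) * real ((n + 1) div 2)"
  show "(\<Sum>i = 1..n. real (card {j \<in> {1..n}. odd (i + j)})) = real n * a"
    unfolding card_odd_shift if_distrib[of real] sum_if_odd a_def using n_pos by simp
  have "\<lfloor>real n / 2\<rfloor> = int (n div 2)"
    using floor_divide_of_nat_eq[of n 2, where ?'a = real] by simp
  moreover have "\<lceil>real n / 2\<rceil> = int ((n + 1) div 2)"
    by (rule ceiling_unique) (auto elim!: oddE evenE simp: field_simps)
  ultimately show "1 / real n * real_of_int \<lfloor>real n / 2\<rfloor> * real_of_int \<lceil>real n / 2\<rceil> = 1 / 2 * a"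
    by (simp add: a_def)
qed simp

end

theorem theorem3p1:
  fixes n :: nat and ord :: "nat list" and \<phi> :: "(nat \<Rightarrow> nat) \<Rightarrow> (nat \<Rightarrow> nat)"
  assumes "n \<ge> 1"
    and "distinct ord" and "set ord = {1..n - 1}"
    and "\<phi> = fold toggle ord"
  shows
    "\<comment> \<open>Entries\<close>
     (\<forall>i\<in>{1..n}. homomesic_avg (perms n) \<phi> (\<lambda>\<pi>. real (\<pi> i)) ((real n + 1) / 2)) \<and>
     homomesic_avg (perms n) \<phi> (\<lambda>\<pi>. real (\<pi> 1)) ((real n + 1) / 2) \<and>
     homomesic_avg (perms n) \<phi> (\<lambda>\<pi>. real (\<pi> n)) ((real n + 1) / 2) \<and>
     homomesic_avg (perms n) \<phi> (\<lambda>\<pi>. real (\<pi> (nat \<lceil>(real n + 1) / 2\<rceil>))) ((real n + 1) / 2) \<and>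
     homomesic_avg (perms n) \<phi> (\<lambda>\<pi>. real (\<pi> (nat \<lfloor>(real n + 1) / 2\<rfloor>))) ((real n + 1) / 2) \<and>
     \<comment> \<open>Excedance-related\<close>
     (\<forall>k\<in>{1..n}. homomesic_avg (perms n) \<phi> (\<lambda>\<pi>. num_indices n (k_excedance k \<pi>))
        ((real n - real k) / real n)) \<and>
     homomesic_avg (perms n) \<phi> (\<lambda>\<pi>. num_indices n (small_excedance \<pi>)) ((real n - 1) / real n) \<and>
     (2 \<le> n \<longrightarrow> homomesic_avg (perms n) \<phi> (\<lambda>\<pi>. num_indices n (k_excedance 2 \<pi>)) ((real n - 2) / real n)) \<and>
     (3 \<le> n \<longrightarrow> homomesic_avg (perms n) \<phi> (\<lambda>\<pi>. num_indices n (k_excedance 3 \<pi>)) ((real n - 3) / real n)) \<and>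
     (\<forall>k\<in>{1..n}. homomesic_avg (perms n) \<phi> (\<lambda>\<pi>. num_indices n (cyclical_k_excedance n k \<pi>)) 1) \<and>
     homomesic_avg (perms n) \<phi> (\<lambda>\<pi>. num_indices n (fixed_point \<pi>)) 1 \<and>
     homomesic_avg (perms n) \<phi> (\<lambda>\<pi>. num_indices n (excedance \<pi>)) ((real n - 1) / 2) \<and>
     homomesic_avg (perms n) \<phi> (\<lambda>\<pi>. num_indices n (weak_excedance \<pi>)) ((real n + 1) / 2) \<and>
     homomesic_avg (perms n) \<phi> (\<lambda>\<pi>. num_indices n (\<lambda>i. \<not> cyclical_small_excedance n \<pi> i)) (real n - 1) \<and>
     (2 \<le> n \<longrightarrow> homomesic_avg (perms n) \<phi> (\<lambda>\<pi>. num_indices n (cyclical_small_weak_excedance n \<pi>)) 2) \<and>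
     (2 \<le> n \<longrightarrow> homomesic_avg (perms n) \<phi>
        (\<lambda>\<pi>. num_indices n (\<lambda>i. \<not> cyclical_small_weak_excedance n \<pi> i)) (real n - 2)) \<and>
     homomesic_avg (perms n) \<phi> (\<lambda>\<pi>. num_indices n (small_weak_excedance \<pi>)) (1 + (real n - 1) / real n) \<and>
     homomesic_avg (perms n) \<phi> (\<lambda>\<pi>. num_indices n (\<lambda>i. \<not> small_weak_excedance \<pi> i))
        ((real n - 1)\<^sup>2 / real n) \<and>
     homomesic_avg (perms n) \<phi> (\<lambda>\<pi>. num_indices n (\<lambda>i. \<not> small_excedance \<pi> i))
        (real n - (real n - 1) / real n) \<and>
     homomesic_avg (perms n) \<phi> (\<lambda>\<pi>. num_indices n (cyclical_small_excedance n \<pi>)) 1 \<and>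
     homomesic_avg (perms n) \<phi> (\<lambda>\<pi>. num_indices n (\<lambda>i. \<not> fixed_point \<pi> i)) (real n - 1) \<and>
     homomesic_avg (perms n) \<phi> (\<lambda>\<pi>. num_indices n (weak_deficiency \<pi>)) ((real n + 1) / 2) \<and>
     homomesic_avg (perms n) \<phi> (\<lambda>\<pi>. num_indices n (deficiency \<pi>)) ((real n - 1) / 2) \<and>
     homomesic_avg (perms n) \<phi> (\<lambda>\<pi>. num_indices n (big_deficiency \<pi>))
        ((real n - 1) * (real n - 2) / (2 * real n)) \<and>
     homomesic_avg (perms n) \<phi> (\<lambda>\<pi>. num_indices n (big_excedance \<pi>))
        ((real n - 1) * (real n - 2) / (2 * real n)) \<and>
     homomesic_avg (perms n) \<phi>
        (\<lambda>\<pi>. num_indices n (\<lambda>i. even i \<and> \<pi> i \<le> i) + num_indices n (\<lambda>i. odd i \<and> \<pi> i \<ge> i))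
        (real_of_int \<lfloor>(real n + 2) / 2\<rfloor>) \<and>
     \<comment> \<open>Inversion-related\<close>
     homomesic_avg (perms n) \<phi> (depth n) (1 / real n * real ((n + 1) choose 3)) \<and>
     homomesic_avg (perms n) \<phi> (inversion_sum n) (1 / 2 * real ((n + 1) choose 3)) \<and>
     homomesic_avg (perms n) \<phi> (non_inversion_sum n) (1 / 2 * real ((n + 1) choose 3)) \<and>
     homomesic_avg (perms n) \<phi> (\<lambda>\<pi>. \<Sum>i = 1..n. (real (\<pi> i) - real i)\<^sup>2) (real ((n + 1) choose 3)) \<and>
     homomesic_avg (perms n) \<phi> (total_displacement n) (2 / real n * real ((n + 1) choose 3)) \<and>
     \<comment> \<open>Others\<close>
     homomesic_avg (perms n) \<phi> (\<lambda>\<pi>. \<Sum>i = 1..n. real i * real (\<pi> i)) ((real n + 1)\<^sup>2 * real n / 4) \<and>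
     homomesic (perms n) \<phi> (\<lambda>\<pi>. num_indices n (\<lambda>i. prime (i + \<pi> i))) \<and>
     homomesic (perms n) \<phi> (\<lambda>\<pi>. num_indices n (\<lambda>i. prime (i * \<pi> i - 1))) \<and>
     homomesic (perms n) \<phi> (\<lambda>\<pi>. num_indices n (\<lambda>i. prime (i * \<pi> i + 1))) \<and>
     homomesic_avg (perms n) \<phi> (\<lambda>\<pi>. real (lcm_sums n) * (\<Sum>i = 1..n. 1 / (real i + real (\<pi> i))))
        (real (lcm_sums n) / real n * ((2 * real n + 1) * harm (2 * n) - (2 * real n + 2) * harm n)) \<and>
     homomesic_avg (perms n) \<phi> (\<lambda>\<pi>. 1 / 2 * num_indices n (\<lambda>i. odd (i + \<pi> i)))
        (1 / real n * real_of_int \<lfloor>real n / 2\<rfloor> * real_of_int \<lceil>real n / 2\<rceil>)"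
proof -
  have ord: "set ord = {1..<n}"
    unfolding assms(3) using assms(1) by (intro set_eqI) auto
  interpret long_cycle_action n "position_perm ord" \<phi>
  proof
    show "position_perm ord permutes {1..n}"
      using ord by (intro position_perm_permutes) simp
    show "cyclic_on (position_perm ord) {1..n}"
      using assms(1,2) ord by (rule cyclic_on_position_perm)
    show "\<phi> \<pi> = \<pi> \<circ> position_perm ord" for \<pi>
      unfolding assms(4) by (rule fold_toggle_eq_comp)
  qed (rule assms(1))
  have "\<lfloor>(real n + 1) / 2\<rfloor> = int ((n + 1) div 2)"
    using floor_divide_of_nat_eq[of "n + 1" 2, where ?'a = real] by (simp add: add.commute)
  moreover have "\<lceil>(real n + 1) / 2\<rceil> = int (n div 2 + 1)"
    by (rule ceiling_unique) (auto elim!: oddE evenE simp: field_simps)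
  ultimately have middle: "nat \<lceil>(real n + 1) / 2\<rceil> \<in> {1..n}" "nat \<lfloor>(real n + 1) / 2\<rfloor> \<in> {1..n}"
    using assms(1) by auto
  have k: "hom (\<lambda>\<pi>. num_indices n (k_excedance 2 \<pi>)) ((real n - 2) / real n)" if "2 \<le> n"
    using hom_k_excedance[of 2] that by simp
  have k': "hom (\<lambda>\<pi>. num_indices n (k_excedance 3 \<pi>)) ((real n - 3) / real n)" if "3 \<le> n"
    using hom_k_excedance[of 3] that by simp
  have ends: "1 \<in> {1..n}" "n \<in> {1..n}" using assms(1) by auto
  have n0: "real n \<noteq> 0" using assms(1) by simp
  have not_small_excedance: "hom (\<lambda>\<pi>. num_indices n (\<lambda>i. \<not> small_excedance \<pi> i))
      (real n - (real n - 1) / real n)"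
    and not_fixed_point: "hom (\<lambda>\<pi>. num_indices n (\<lambda>i. \<not> fixed_point \<pi> i)) (real n - 1)"
    and not_cyclical_small: "hom (\<lambda>\<pi>. num_indices n (\<lambda>i. \<not> cyclical_small_excedance n \<pi> i))
      (real n - 1)"
    by (rule hom_num_indices_not[OF _ refl] hom_small_excedance hom_fixed_point
        hom_cyclical_small_excedance)+
  have not_cyclical_small_weak: "hom (\<lambda>\<pi>. num_indices n
      (\<lambda>i. \<not> cyclical_small_weak_excedance n \<pi> i)) (real n - 2)" if "2 \<le> n"
    by (rule hom_num_indices_not[OF hom_cyclical_small_weak_excedance[OF that] refl])
  have not_small_weak: "hom (\<lambda>\<pi>. num_indices n (\<lambda>i. \<not> small_weak_excedance \<pi> i))
      ((real n - 1)\<^sup>2 / real n)"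
    by (rule hom_num_indices_not[OF hom_small_weak_excedance])
       (use n0 in \<open>simp add: field_simps power2_eq_square\<close>)
  \<comment> \<open>The relations with primes are given explicitly, since \<open>R i (\<pi> i)\<close> is not a higher-order
    pattern and unification has several solutions for \<open>R\<close>.\<close>
  show ?thesis
    by (intro conjI ballI impI)
       (assumption | rule middle ends hom_entry hom_k_excedance hom_small_excedance
        k k' hom_cyclical_k_excedance hom_fixed_point hom_excedance hom_weak_excedance
        not_cyclical_small hom_cyclical_small_weak_excedance not_cyclical_small_weak
        hom_small_weak_excedance not_small_weak not_small_excedance hom_cyclical_small_excedance
        not_fixed_point hom_weak_deficiency hom_deficiency hom_big_deficiency hom_big_excedance
        hom_even_weak_deficiency_odd_weak_excedance hom_depth hom_inversion_sum
        hom_non_inversion_sum hom_squared_displacement hom_total_displacement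
        hom_index_times_entry hom_reciprocal_sums hom_half_odd_sums
        homomesic_num_indices[of "\<lambda>i j. prime (i + j)"]
        homomesic_num_indices[of "\<lambda>i j. prime (i * j - 1)"]
        homomesic_num_indices[of "\<lambda>i j. prime (i * j + 1)"])+
qed

end
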